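(* Let $\alpha\in(0,1)$, let $\rho_{AB}$ be a pure state on $\mathbb{C}_A\otimes\mathbb{C}_B$, and let $\rho_{ABE}$ be a pure state on $\mathbb{C}_A\otimes\mathbb{C}_B\otimes\mathbb{C}_E$ with $\mathrm{Tr}_E(\rho_{ABE})=\rho_{AB}$. Write $\rho_{AE}=\mathrm{Tr}_B(\rho_{ABE})$ and $\rho_A=\mathrm{Tr}_B(\rho_{AB})$. Then, for every POVM $\mathcal{M}_E$ on $E$, the ensemble $\xi_{AE}^{\mathcal{M}_E}$ created on $A$ satisfies $Q_\alpha(\xi_{AE}^{\mathcal{M}_E})=0$, and therefore $$E_f^{\alpha}(\rho_{AB})=S_\alpha(\rho_A).$$
   Context: All Hilbert spaces $\mathbb{C}_A,\mathbb{C}_B,\mathbb{C}_E$ are finite-dimensional complex Hilbert spaces. A state is a positive semidefinite operator of trace one. Quantum $\alpha$-Rényi entropy: $S_\alpha(\rho)=\frac{1}{1-\alpha}\log\mathrm{Tr}(\rho^\alpha)$. $\alpha$-quantum Jensen-Shannon divergence of an ensemble $\xi=\{p_k,\rho_k\}_k$ of states: $Q_\alpha(\xi)=S_\alpha\big(\sum_k p_k\rho_k\big)-\sum_k p_kS_\alpha(\rho_k)$. For a bipartite state $\rho_{AE}$ and a POVM $\mathcal{M}_E=\{M_x\}_x$ on $E$ (finitely many positive semidefinite operators summing to the identity), the ensemble created on $A$ is $\xi_{AE}^{\mathcal{M}_E}=\{p_x,\rho_x^A\}_x$, where $p_x\rho_x^A=\mathrm{Tr}_E\big((\mathbb{I}_A\otimes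 M_x)\rho_{AE}\big)$ and $p_x$ is the trace of this operator (terms with $p_x=0$ are dropped). $\alpha$-entanglement of formation of a bipartite state: $E_f^\alpha(\rho_{AB})=\inf\sum_i p_iS_\alpha\big(\mathrm{Tr}_B|\psi_i\rangle\langle\psi_i|\big)$, the infimum being over all finite pure-state ensembles $\{p_i,|\psi_i\rangle\langle\psi_i|\}_i$ with $\rho_{AB}=\sum_ip_i|\psi_i\rangle\langle\psi_i|$. *)

theory Defs
  imports "HOL-Analysis.Analysis"
begin

text \<open>Operators on a finite-dimensional Hilbert space with orthonormal basis indexed by a finite
  type are square complex matrices; the tensor product of two spaces is indexed by pairs, and a
  tripartite space \<open>A \<otimes> B \<otimes> E\<close> is indexed by \<open>('a \<times> 'b) \<times> 'e\<close>.\<close>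

type_synonym 'n op = "complex ^ 'n ^ 'n"

definition cadjoint :: "complex ^ 'n::finite ^ 'm::finite \<Rightarrow> complex ^ 'm ^ 'n" where
  "cadjoint A = (\<chi> i j. cnj (A $ j $ i))"

definition cinner :: "complex ^ 'n::finite \<Rightarrow> complex ^ 'n \<Rightarrow> complex" where
  "cinner v w = (\<Sum>i\<in>UNIV. cnj (v $ i) * w $ i)"

definition psd :: "('n::finite) op \<Rightarrow> bool" where
  "psd A \<longleftrightarrow> cadjoint A = A \<and> (\<forall>v. 0 \<le> Re (cinner v (A *v v)))"

definition unitary :: "('n::finite) op \<Rightarrow> bool" where
  "unitary U \<longleftrightarrow> cadjoint U ** U = mat 1 \<and> U ** cadjoint U = mat 1"

definition diag_op :: "('n::finite \<Rightarrow> real) \<Rightarrow> 'n op" where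
  "diag_op d = (\<chi> i j. if i = j then complex_of_real (d i) else 0)"

text \<open>Real power of a positive semidefinite operator by functional calculus. A diagonalisation
  exists by the spectral theorem; the result does not depend on the one chosen, see
  \<open>op_powr_eqI\<close>. Zero eigenvalues stay zero, since \<open>0 powr r = 0\<close>.\<close>

definition op_powr :: "('n::finite) op \<Rightarrow> real \<Rightarrow> 'n op" where
  "op_powr A r = (THE B. \<exists>U d. unitary U \<and> (\<forall>i. 0 \<le> d i) \<and>
     A = U ** diag_op d ** cadjoint U \<and>
     B = U ** diag_op (\<lambda>i. d i powr r) ** cadjoint U)"

lemma diag_op_mult_left: "(diag_op d ** W) $ i $ j = complex_of_real (d i) * W $ i $ j"
  for W :: "('n::finite) op"
  by (simp add: diag_op_def matrix_matrix_mult_def if_distrib if_distribR cong: if_cong)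

lemma diag_op_mult_right: "(W ** diag_op d) $ i $ j = W $ i $ j * complex_of_real (d j)"
  for W :: "('n::finite) op"
  by (simp add: diag_op_def matrix_matrix_mult_def if_distrib if_distribR cong: if_cong)

lemma diagonalisation_powr_unique:
  fixes U V :: "('n::finite) op"
  assumes U: "unitary U" and V: "unitary V"
    and eq: "U ** diag_op d ** cadjoint U = V ** diag_op e ** cadjoint V"
  shows "U ** diag_op (\<lambda>i. d i powr r) ** cadjoint U
       = V ** diag_op (\<lambda>i. e i powr r) ** cadjoint V"
proof -
  define W where "W = cadjoint V ** U"
  have UU: "cadjoint U ** U = mat 1" "U ** cadjoint U = mat 1"
    and VV: "cadjoint V ** V = mat 1" "V ** cadjoint V = mat 1"
    using U V by (auto simp: unitary_def)
  have "W ** diag_op d = cadjoint V ** (U ** diag_op d ** cadjoint U) ** U"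
    by (simp add: W_def UU flip: matrix_mul_assoc)
  also have "\<dots> = (cadjoint V ** V) ** diag_op e ** W"
    by (simp add: eq W_def matrix_mul_assoc)
  finally have "W ** diag_op d = diag_op e ** W"
    by (simp add: VV)
  then have "W $ i $ j * complex_of_real (d j) = complex_of_real (e i) * W $ i $ j" for i j
    by (metis diag_op_mult_left diag_op_mult_right)
  then have "W $ i $ j = 0 \<or> d j = e i" for i j
    by (metis mult.commute mult_right_cancel of_real_eq_iff)
  then have "W ** diag_op (\<lambda>i. d i powr r) = diag_op (\<lambda>i. e i powr r) ** W"
    unfolding vec_eq_iff diag_op_mult_left diag_op_mult_right
    by (metis mult.commute mult_zero_left)
  then have "V ** (W ** diag_op (\<lambda>i. d i powr r)) ** cadjoint U
      = V ** (diag_op (\<lambda>i. e i powr r) ** W) ** cadjoint U"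
    by simp
  moreover have "V ** (W ** diag_op (\<lambda>i. d i powr r)) ** cadjoint U
      = (V ** cadjoint V) ** U ** diag_op (\<lambda>i. d i powr r) ** cadjoint U"
    by (simp add: W_def matrix_mul_assoc)
  moreover have "V ** (diag_op (\<lambda>i. e i powr r) ** W) ** cadjoint U
      = V ** diag_op (\<lambda>i. e i powr r) ** cadjoint V ** (U ** cadjoint U)"
    by (simp add: W_def matrix_mul_assoc)
  ultimately show ?thesis
    by (simp add: UU VV)
qed

lemma op_powr_eqI:
  assumes "unitary U" "\<And>i. 0 \<le> d i" "A = U ** diag_op d ** cadjoint U"
  shows "op_powr A r = U ** diag_op (\<lambda>i. d i powr r) ** cadjoint U"
  unfolding op_powr_def
proof (rule the_equality)
  show "\<exists>U' d'. unitary U' \<and> (\<forall>i. 0 \<le> d' i) \<and> A = U' ** diag_op d' ** cadjoint U' \<and>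
      U ** diag_op (\<lambda>i. d i powr r) ** cadjoint U
      = U' ** diag_op (\<lambda>i. d' i powr r) ** cadjoint U'"
    using assms by blast
  show "B = U ** diag_op (\<lambda>i. d i powr r) ** cadjoint U"
    if "\<exists>U' d'. unitary U' \<and> (\<forall>i. 0 \<le> d' i) \<and> A = U' ** diag_op d' ** cadjoint U' \<and>
      B = U' ** diag_op (\<lambda>i. d' i powr r) ** cadjoint U'" for B
    using that assms diagonalisation_powr_unique by metis
qed

definition renyi_entropy :: "real \<Rightarrow> ('n::finite) op \<Rightarrow> real" where
  "renyi_entropy \<alpha> \<rho> = 1 / (1 - \<alpha>) * log 2 (Re (trace (op_powr \<rho> \<alpha>)))"

definition ketbra :: "complex ^ 'n::finite \<Rightarrow> 'n op" where
  "ketbra \<psi> = (\<chi> i j. \<psi> $ i * cnj (\<psi> $ j))"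

definition pure_state :: "('n::finite) op \<Rightarrow> bool" where
  "pure_state \<rho> \<longleftrightarrow> (\<exists>\<psi>. norm \<psi> = 1 \<and> \<rho> = ketbra \<psi>)"

definition tensor_op :: "('a::finite) op \<Rightarrow> ('b::finite) op \<Rightarrow> ('a \<times> 'b) op" where
  "tensor_op A B = (\<chi> i j. A $ fst i $ fst j * B $ snd i $ snd j)"

definition ptrace_snd :: "('a::finite \<times> 'b::finite) op \<Rightarrow> 'a op" where
  "ptrace_snd R = (\<chi> i j. \<Sum>k\<in>UNIV. R $ (i, k) $ (j, k))"

text \<open>The partial trace over the middle factor \<open>B\<close> of \<open>A \<otimes> B \<otimes> E\<close>.\<close>

definition ptrace_mid :: "(('a::finite \<times> 'b::finite) \<times> 'e::finite) op \<Rightarrow> ('a \<times> 'e) op" where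
  "ptrace_mid R = (\<chi> i j. \<Sum>k\<in>UNIV. R $ ((fst i, k), snd i) $ ((fst j, k), snd j))"

text \<open>An ensemble \<open>{p\<^sub>k, \<rho>\<^sub>k}\<close> is given by its index set, its weights and its states.\<close>

type_synonym ('k, 'n) ensemble = "'k set \<times> ('k \<Rightarrow> real) \<times> ('k \<Rightarrow> 'n op)"

definition qjsd :: "real \<Rightarrow> ('k, 'n::finite) ensemble \<Rightarrow> real" where
  "qjsd \<alpha> = (\<lambda>(K, p, \<rho>).
     renyi_entropy \<alpha> (\<Sum>k\<in>K. p k *\<^sub>R \<rho> k) - (\<Sum>k\<in>K. p k * renyi_entropy \<alpha> (\<rho> k)))"

definition povm :: "'x set \<Rightarrow> ('x \<Rightarrow> ('e::finite) op) \<Rightarrow> bool" where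
  "povm X M \<longleftrightarrow> finite X \<and> (\<forall>x\<in>X. psd (M x)) \<and> (\<Sum>x\<in>X. M x) = mat 1"

definition unnormalised_post :: "('a::finite \<times> 'e::finite) op \<Rightarrow> 'e op \<Rightarrow> 'a op" where
  "unnormalised_post \<rho> E = ptrace_snd (tensor_op (mat 1) E ** \<rho>)"

definition outcome_prob :: "('a::finite \<times> 'e::finite) op \<Rightarrow> 'e op \<Rightarrow> real" where
  "outcome_prob \<rho> E = Re (trace (unnormalised_post \<rho> E))"

definition created_ensemble ::
  "('a::finite \<times> 'e::finite) op \<Rightarrow> 'x set \<Rightarrow> ('x \<Rightarrow> 'e op) \<Rightarrow> ('x, 'a) ensemble" where
  "created_ensemble \<rho> X M =
     ({x \<in> X. outcome_prob \<rho> (M x) \<noteq> 0},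
      \<lambda>x. outcome_prob \<rho> (M x),
      \<lambda>x. (1 / outcome_prob \<rho> (M x)) *\<^sub>R unnormalised_post \<rho> (M x))"

definition pure_decomposition ::
  "('n::finite) op \<Rightarrow> nat \<Rightarrow> (nat \<Rightarrow> real) \<Rightarrow> (nat \<Rightarrow> complex ^ 'n) \<Rightarrow> bool" where
  "pure_decomposition \<rho> n p \<psi> \<longleftrightarrow>
     (\<forall>i<n. 0 \<le> p i \<and> norm (\<psi> i) = 1) \<and> (\<Sum>i<n. p i) = 1 \<and>
     \<rho> = (\<Sum>i<n. p i *\<^sub>R ketbra (\<psi> i))"

definition ent_formation :: "real \<Rightarrow> ('a::finite \<times> 'b::finite) op \<Rightarrow> real" where
  "ent_formation \<alpha> \<rho> =
     Inf {(\<Sum>i<n. p i * renyi_entropy \<alpha> (ptrace_snd (ketbra (\<psi> i)))) | n p \<psi>.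
          pure_decomposition \<rho> n p \<psi>}"

end

theory Submission
  imports Defs
begin

text \<open>A pure state admits only the trivial decomposition: if \<open>\<Sum>\<^sub>k |w\<^sub>k\<rangle>\<langle>w\<^sub>k| = |\<phi>\<rangle>\<langle>\<phi>|\<close> then each \<open>w\<^sub>k\<close> is a
  multiple of \<open>\<phi>\<close>. Applied to the slices of the purification along \<open>E\<close>, this gives
  \<open>\<Psi> = \<phi> \<otimes> c\<close>, so \<open>\<rho>\<^sub>A\<^sub>E\<close> is a product and each measurement outcome leaves \<open>\<rho>\<^sub>A\<close> unchanged.
  Applied to a pure-state ensemble, it shows that each member of positive weight is \<open>\<rho>\<^sub>A\<^sub>B\<close>
  itself, so the infimum is over a single value.\<close>

lemma ketbra_nth [simp]: "ketbra \<psi> $ i $ j = \<psi> $ i * cnj (\<psi> $ j)"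
  by (simp add: ketbra_def)

lemma trace_ketbra: "trace (ketbra \<psi>) = complex_of_real ((norm \<psi>)\<^sup>2)"
  by (simp add: trace_def norm_vec_def L2_set_def sum_nonneg complex_norm_square del: of_real_power)

lemma ketbra_scaleR: "ketbra (r *\<^sub>R \<psi>) = r\<^sup>2 *\<^sub>R ketbra \<psi>"
  by (simp add: vec_eq_iff power2_eq_square scaleR_conv_of_real[where 'a=complex])

lemma ketbra_smult: "ketbra (c *s \<psi>) = (cmod c)\<^sup>2 *\<^sub>R ketbra \<psi>"
  unfolding vec_eq_iff
  by (simp add: scaleR_conv_of_real[where 'a=complex] complex_norm_square del: of_real_power)

text \<open>Proportionality to \<open>\<phi>\<close> is the vanishing of the 2x2 minors of
  \<open>w k\<close> against \<open>\<phi>\<close>. Summed over \<open>k\<close>, their squared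
  moduli depend on the \<open>w k\<close> only through the entries of the sum of projectors, so the
  sum takes the value it would have for \<open>\<phi>\<close> alone, which is zero.\<close>

lemma ketbra_eq_sum_ketbraE:
  fixes \<phi> :: "complex ^ 'n::finite"
  assumes "finite K" and "\<phi> \<noteq> 0" and sum: "(\<Sum>k\<in>K. ketbra (w k)) = ketbra \<phi>"
  obtains c where "\<And>k. k \<in> K \<Longrightarrow> w k = c k *s \<phi>" and "(\<Sum>k\<in>K. (cmod (c k))\<^sup>2) = 1"
proof -
  obtain m where m: "\<phi> $ m \<noteq> 0"
    using \<open>\<phi> \<noteq> 0\<close> by (auto simp: vec_eq_iff)
  have nth: "(\<Sum>k\<in>K. w k $ i * cnj (w k $ j)) = \<phi> $ i * cnj (\<phi> $ j)" for i j
    using arg_cong[OF sum, of "\<lambda>R. R $ i $ j"] by simp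
  have minor: "w k $ i * \<phi> $ m = w k $ m * \<phi> $ i" if "k \<in> K" for k i
  proof -
    let ?z = "\<lambda>k. w k $ i * \<phi> $ m - w k $ m * \<phi> $ i"
    have "complex_of_real (\<Sum>k\<in>K. (cmod (?z k))\<^sup>2) = (\<Sum>k\<in>K. ?z k * cnj (?z k))"
      by (simp add: complex_norm_square del: of_real_power complex_cnj_diff complex_cnj_mult)
    \<comment> \<open>By \<open>nth\<close>, all four products become the same number, with signs +,
      -, -, +.\<close>
    also have "\<dots> = (\<Sum>k\<in>K. w k $ i * cnj (w k $ i)) * (\<phi> $ m * cnj (\<phi> $ m))
        - (\<Sum>k\<in>K. w k $ i * cnj (w k $ m)) * (\<phi> $ m * cnj (\<phi> $ i))
        - (\<Sum>k\<in>K. w k $ m * cnj (w k $ i)) * (\<phi> $ i * cnj (\<phi> $ m))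
        + (\<Sum>k\<in>K. w k $ m * cnj (w k $ m)) * (\<phi> $ i * cnj (\<phi> $ i))"
      by (simp only: sum_distrib_right flip: sum.distrib sum_subtractf)
        (rule sum.cong, simp_all add: algebra_simps)
    also have "\<dots> = 0"
      by (simp add: nth)
    finally have "(\<Sum>k\<in>K. (cmod (?z k))\<^sup>2) = 0"
      by (simp only: of_real_eq_0_iff)
    then show ?thesis
      using that \<open>finite K\<close> by (simp add: sum_nonneg_eq_0_iff)
  qed
  define c where "c k = w k $ m / \<phi> $ m" for k
  have w: "w k = c k *s \<phi>" if "k \<in> K" for k
    using minor[OF that] m by (simp add: vec_eq_iff c_def field_simps)
  have "(\<Sum>k\<in>K. (cmod (c k))\<^sup>2) *\<^sub>R ketbra \<phi> = ketbra \<phi>"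
    using sum by (simp add: w ketbra_smult scaleR_sum_left)
  \<comment> \<open>The diagonal entry at \<open>m\<close> is nonzero and can be cancelled.\<close>
  from arg_cong[OF this, of "\<lambda>R. R $ m $ m"] have "(\<Sum>k\<in>K. (cmod (c k))\<^sup>2) = 1"
    using m by (simp add: scaleR_conv_of_real[where 'a=complex] del: of_real_sum of_real_power)
  with w show ?thesis
    by (rule that)
qed

text \<open>Brings the reduced state of a pure state into the form to which
  \<open>ketbra_eq_sum_ketbraE\<close> applies.\<close>

lemma ptrace_snd_ketbra: "ptrace_snd (ketbra \<Psi>) = (\<Sum>k\<in>UNIV. ketbra (\<chi> i. \<Psi> $ (i, k)))"
  by (simp add: vec_eq_iff ptrace_snd_def)

lemma trace_ptrace_snd: "trace (ptrace_snd R) = trace R"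
  by (simp add: trace_def ptrace_snd_def sum.cartesian_product case_prod_beta
      flip: UNIV_Times_UNIV)

lemma ptrace_mid_product:
  fixes c :: "complex ^ 'e::finite"
  assumes "\<And>i k. \<Psi> $ (i, k) = \<phi> $ i * c $ k"
  shows "ptrace_mid (ketbra \<Psi>) = tensor_op (ptrace_snd (ketbra \<phi>)) (ketbra c)"
  by (simp add: vec_eq_iff ptrace_mid_def ptrace_snd_def tensor_op_def assms
      sum_distrib_left sum_distrib_right mult_ac)

lemma tensor_op_mult: "tensor_op A B ** tensor_op C D = tensor_op (A ** C) (B ** D)"
  by (simp add: vec_eq_iff tensor_op_def matrix_matrix_mult_def sum_product mult_ac
      sum.cartesian_product case_prod_beta flip: UNIV_Times_UNIV)

lemma ptrace_snd_tensor_op: "ptrace_snd (tensor_op A B) $ i $ j = A $ i $ j * trace B"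
  by (simp add: ptrace_snd_def tensor_op_def trace_def sum_distrib_left)

lemma trace_mult_ketbra: "trace (A ** ketbra c) = cinner c (A *v c)"
  by (simp add: trace_def matrix_matrix_mult_def cinner_def matrix_vector_mult_def
      sum_distrib_left mult_ac)

lemma cnj_cinner: "cnj (cinner v w) = cinner w v"
  by (simp add: cinner_def mult_ac)

lemma cinner_cadjoint: "cinner v (A *v w) = cinner (cadjoint A *v v) w"
proof -
  have "cinner v (A *v w) = (\<Sum>i\<in>UNIV. \<Sum>j\<in>UNIV. cnj (v $ i) * A $ i $ j * w $ j)"
    by (simp add: cinner_def matrix_vector_mult_def sum_distrib_left mult_ac)
  also have "\<dots> = (\<Sum>j\<in>UNIV. \<Sum>i\<in>UNIV. cnj (v $ i) * A $ i $ j * w $ j)"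
    by (rule sum.swap)
  also have "\<dots> = cinner (cadjoint A *v v) w"
    by (simp add: cinner_def matrix_vector_mult_def cadjoint_def sum_distrib_left
        sum_distrib_right mult_ac)
  finally show ?thesis .
qed

text \<open>Self-adjointness makes the quadratic form real. This links the complex factor left by
  the partial trace to the real part taken in \<open>outcome_prob\<close>.\<close>

lemma psd_cinner_real:
  assumes "psd A"
  shows "cinner v (A *v v) = complex_of_real (Re (cinner v (A *v v)))"
proof -
  have "cnj (cinner v (A *v v)) = cinner v (A *v v)"
    using assms by (metis psd_def cnj_cinner cinner_cadjoint)
  then show ?thesis
    by (metis Reals_cnj_iff of_real_Re)
qed

text \<open>The measurement acts only on the second factor of the product, and tracing that factor
  out leaves the scalar \<open>trace (E ** ketbra c)\<close>.\<close>

lemma unnormalised_post_tensor_ketbra: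
  assumes "psd E"
  shows "unnormalised_post (tensor_op \<rho> (ketbra c)) E = Re (cinner c (E *v c)) *\<^sub>R \<rho>"
  unfolding unnormalised_post_def tensor_op_mult vec_eq_iff
  using psd_cinner_real[OF assms, of c]
  by (simp add: ptrace_snd_tensor_op trace_mult_ketbra scaleR_conv_of_real[where 'a=complex] mult.commute)

lemma sum_matrix_vector_mult: "(\<Sum>x\<in>X. M x) *v v = (\<Sum>x\<in>X. M x *v v)"
  for M :: "'x \<Rightarrow> ('e::finite) op"
  by (induction X rule: infinite_finite_induct) (auto simp: matrix_vector_mult_add_rdistrib)

lemma povm_sum_cinner:
  assumes "povm X M"
  shows "(\<Sum>x\<in>X. cinner c (M x *v c)) = complex_of_real ((norm c)\<^sup>2)"
proof -
  have "(\<Sum>x\<in>X. cinner c (M x *v c)) = trace ((\<Sum>x\<in>X. M x) ** ketbra c)"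
    unfolding trace_mult_ketbra sum_matrix_vector_mult
    by (simp add: cinner_def sum_distrib_left sum.swap[of _ X])
  then show ?thesis
    using assms by (simp add: povm_def trace_ketbra)
qed

lemma qjsd_constant:
  assumes "(\<Sum>k\<in>K. p k) = 1" and "\<And>k. k \<in> K \<Longrightarrow> \<rho> k = \<sigma>"
  shows "qjsd \<alpha> (K, p, \<rho>) = 0"
proof -
  have "(\<Sum>k\<in>K. p k *\<^sub>R \<rho> k) = \<sigma>"
    using assms by (simp flip: scaleR_sum_left)
  moreover have "(\<Sum>k\<in>K. p k * renyi_entropy \<alpha> (\<rho> k)) = renyi_entropy \<alpha> \<sigma>"
    using assms by (simp flip: sum_distrib_right)
  ultimately show ?thesis
    by (simp add: qjsd_def)
qed

text \<open>Since \<open>\<rho>\<close> has trace one, the scalar in front of it is the outcome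
  probability. Normalising cancels it, so every retained member of the ensemble is
  \<open>\<rho>\<close> and \<open>qjsd_constant\<close> applies.\<close>

lemma qjsd_created_ensemble_tensor_ketbra:
  assumes "povm X M" and tr: "trace \<rho> = 1" and c: "norm c = 1"
  shows "qjsd \<alpha> (created_ensemble (tensor_op \<rho> (ketbra c)) X M) = 0"
proof -
  let ?R = "tensor_op \<rho> (ketbra c)"
  have X: "finite X" "\<And>x. x \<in> X \<Longrightarrow> psd (M x)"
    using assms by (auto simp: povm_def)
  have tr_scale: "trace (r *\<^sub>R \<rho>) = of_real r" for r
    using tr by (simp add: trace_def scaleR_conv_of_real[where 'a=complex] flip: sum_distrib_left)
  have prob: "outcome_prob ?R (M x) = Re (cinner c (M x *v c))" if "x \<in> X" for x
    using X(2)[OF that] by (simp add: outcome_prob_def unnormalised_post_tensor_ketbra tr_scale)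
  \<comment> \<open>The dropped outcomes have probability zero, so the retained weights still sum to
    one.\<close>
  have "(\<Sum>x | x \<in> X \<and> outcome_prob ?R (M x) \<noteq> 0. outcome_prob ?R (M x))
      = (\<Sum>x\<in>X. outcome_prob ?R (M x))"
    using X(1) by (intro sum.mono_neutral_left) auto
  also have "\<dots> = Re (\<Sum>x\<in>X. cinner c (M x *v c))"
    by (simp add: prob)
  also have "\<dots> = 1"
    using povm_sum_cinner[OF \<open>povm X M\<close>] c by simp
  finally show ?thesis
    unfolding created_ensemble_def
    by (rule qjsd_constant[where \<sigma> = \<rho>])
      (use X in \<open>auto simp: prob unnormalised_post_tensor_ketbra\<close>)
qed

lemma pure_decomposition_ketbra:
  assumes "pure_decomposition (ketbra \<phi>) n p \<psi>" and "norm \<phi> = 1" and "i < n" and "p i \<noteq> 0"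
  shows "ketbra (\<psi> i) = ketbra \<phi>"
proof -
  have p: "0 \<le> p j" "norm (\<psi> j) = 1" if "j < n" for j
    using assms(1) that by (auto simp: pure_decomposition_def)
  \<comment> \<open>The weights are absorbed into the vectors as square roots.\<close>
  have sum: "(\<Sum>j<n. ketbra (sqrt (p j) *\<^sub>R \<psi> j)) = ketbra \<phi>"
    using assms(1) by (simp add: pure_decomposition_def ketbra_scaleR)
  have "\<phi> \<noteq> 0"
    using assms(2) by auto
  obtain c where "\<And>j. j \<in> {..<n} \<Longrightarrow> sqrt (p j) *\<^sub>R \<psi> j = c j *s \<phi>"
    by (rule ketbra_eq_sum_ketbraE[OF finite_lessThan \<open>\<phi> \<noteq> 0\<close> sum]) blast
  then have "ketbra (sqrt (p i) *\<^sub>R \<psi> i) = ketbra (c i *s \<phi>)"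
    using \<open>i < n\<close> by simp
  then have eq: "p i *\<^sub>R ketbra (\<psi> i) = (cmod (c i))\<^sup>2 *\<^sub>R ketbra \<phi>"
    using p[OF \<open>i < n\<close>] by (simp add: ketbra_scaleR ketbra_smult)
  have tr_scale: "trace (r *\<^sub>R R) = of_real r * trace R" for r and R :: "'a op"
    by (simp add: trace_def scaleR_conv_of_real[where 'a=complex] sum_distrib_left)
  \<comment> \<open>Both projectors have trace one, so the two scalars agree and can be
    cancelled.\<close>
  from arg_cong[OF eq, of trace] have "p i = (cmod (c i))\<^sup>2"
    using p[OF \<open>i < n\<close>] assms(2) by (simp add: tr_scale trace_ketbra del: of_real_power)
  with eq \<open>p i \<noteq> 0\<close> show ?thesis
    by simp
qed

lemma ent_formation_ketbra:
  assumes "norm \<phi> = 1"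
  shows "ent_formation \<alpha> (ketbra \<phi>) = renyi_entropy \<alpha> (ptrace_snd (ketbra \<phi>))"
proof -
  let ?S = "renyi_entropy \<alpha> (ptrace_snd (ketbra \<phi>))"
  let ?f = "\<lambda>n p \<psi>. \<Sum>i<n. p i * renyi_entropy \<alpha> (ptrace_snd (ketbra (\<psi> i)))"
  have val: "?f n p \<psi> = ?S" if "pure_decomposition (ketbra \<phi>) n p \<psi>" for n p \<psi>
  proof -
    have "?f n p \<psi> = (\<Sum>i<n. p i * ?S)"
      \<comment> \<open>Members of weight zero may be arbitrary unit vectors, but their terms vanish
        on both sides.\<close>
      by (rule sum.cong) (use pure_decomposition_ketbra[OF that assms] in force)+
    also have "\<dots> = ?S"
      using that by (simp add: pure_decomposition_def flip: sum_distrib_right)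
    finally show ?thesis .
  qed
  have dec: "pure_decomposition (ketbra \<phi>) 1 (\<lambda>_. 1) (\<lambda>_. \<phi>)"
    using assms by (simp add: pure_decomposition_def)
  \<comment> \<open>The one-term decomposition makes the set nonempty, so \<open>Inf\<close> is
    taken over a singleton.\<close>
  have "?S \<in> {?f n p \<psi> | n p \<psi>. pure_decomposition (ketbra \<phi>) n p \<psi>}"
    by (intro CollectI exI[of _ 1] exI[of _ "\<lambda>_. 1"] exI[of _ "\<lambda>_. \<phi>"])
      (use dec in simp)
  with val have "{?f n p \<psi> | n p \<psi>. pure_decomposition (ketbra \<phi>) n p \<psi>} = {?S}"
    by (intro equalityI subsetI) (auto simp only: mem_Collect_eq singleton_iff)
  then show ?thesis
    by (simp add: ent_formation_def)
qed

theorem theorem14: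
  fixes \<alpha> :: real
    and \<rho>AB :: "('a::finite \<times> 'b::finite) op"
    and \<rho>ABE :: "(('a \<times> 'b) \<times> 'e::finite) op"
    and \<rho>AE :: "('a \<times> 'e) op"
    and \<rho>A :: "'a op"
  assumes "0 < \<alpha>" and "\<alpha> < 1"
    and "pure_state \<rho>AB"
    and "pure_state \<rho>ABE"
    and "ptrace_snd \<rho>ABE = \<rho>AB"
    and "\<rho>AE = ptrace_mid \<rho>ABE"
    and "\<rho>A = ptrace_snd \<rho>AB"
  shows "(\<forall>(X :: 'x set) M. povm X M \<longrightarrow> qjsd \<alpha> (created_ensemble \<rho>AE X M) = 0) \<and>
         ent_formation \<alpha> \<rho>AB = renyi_entropy \<alpha> \<rho>A"
proof -
  obtain \<phi> where \<phi>: "norm \<phi> = 1" "\<rho>AB = ketbra \<phi>"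
    using assms(3) by (auto simp: pure_state_def)
  obtain \<Psi> where \<Psi>: "\<rho>ABE = ketbra \<Psi>"
    using assms(4) by (auto simp: pure_state_def)
  have "(\<Sum>k\<in>UNIV. ketbra (\<chi> i. \<Psi> $ (i, k))) = ketbra \<phi>"
    using assms(5) by (simp add: \<phi> \<Psi> ptrace_snd_ketbra)
  moreover have "\<phi> \<noteq> 0"
    using \<phi>(1) by auto
  ultimately obtain c where c: "\<And>k. (\<chi> i. \<Psi> $ (i, k)) = c k *s \<phi>"
      and c1: "(\<Sum>k\<in>UNIV. (cmod (c k))\<^sup>2) = 1"
    using ketbra_eq_sum_ketbraE[of UNIV] by (metis finite_class.finite_UNIV UNIV_I)
  \<comment> \<open>The proportionality factors of the slices are the coordinates of the state on
    \<open>E\<close>; \<open>c1\<close> says that it is a unit vector.\<close>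
  define v where "v = (\<chi> k. c k)"
  have "\<Psi> $ (i, k) = \<phi> $ i * v $ k" for i k
    using arg_cong[OF c, of "\<lambda>u. u $ i" k] by (simp add: v_def)
  then have "\<rho>AE = tensor_op \<rho>A (ketbra v)"
    using assms(6,7) by (simp add: \<phi> \<Psi> ptrace_mid_product)
  moreover have "trace \<rho>A = 1"
    using assms(7) \<phi> by (simp add: trace_ptrace_snd trace_ketbra)
  moreover have "norm v = 1"
    using c1 by (simp add: v_def norm_vec_def L2_set_def)
  ultimately show ?thesis
    using qjsd_created_ensemble_tensor_ketbra ent_formation_ketbra[OF \<phi>(1)] assms(7) \<phi>(2)
    by blast
qed

end
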